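(* Let $f\in L^1([0,1]^2)$ and suppose that $\omega(f;u,v)_1=O(uv)$, i.e. there is a constant $C$ with $\omega(f;u,v)_1\le C\,uv$ for all $u,v>0$. Then there exist a function $g\in H_1^{(2)}$ and univariate functions $\phi_1,\phi_2$ such that for a.e. $(x,y)\in\mathbb{R}^2$ $$f(x,y)=g(x,y)+\phi_1(x)+\phi_2(y).$$ Moreover, $$v_1^{(2)}(g)=\sup_{u,v>0}\frac{\omega(f;u,v)_1}{uv}.$$
   Context: Functions are real-valued. $L^1([0,1]^2)$ is the class of measurable functions $f$ on $\mathbb{R}^2$ that are 1-periodic in each variable with $\|f\|_1=\int_{[0,1]^2}|f|<\infty$. For $s,t\in\mathbb{R}$, $\Delta(s,t)f(x,y)=f(x+s,y+t)-f(x+s,y)-f(x,y+t)+f(x,y)$, and the mixed $L^1$-modulus of continuity is $\omega(f;u,v)_1=\sup_{0\le s\le u,\,0\le t\le v}\|\Delta(s,t)f\|_1$. For a 1-periodic function $h$ on $\mathbb{R}$, $v_1(h)=\sup_\Pi\sum_{k=0}^{n-1}|h(x_{k+1})-h(x_k)|$, the supremum over all partitions $\Pi=\{x_0<x_1<\dots<x_n=x_0+1\}$; $h\in V_1$ means $v_1(h)<\infty$. For a function $g(x,y)$ on $\mathbb{R}^2$, 1-periodic in both variables, $$v_1^{(2)}(g)=\sup_{\mathcal N}\sum_{i=0}^{m-1}\sum_{j=0}^{n-1}|g(x_{i+1},y_{j+1})-g(x_{i+1},y_j)-g(x_i,y_{j+1})+g(x_i,y_j)|,$$ the supremum over all nets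 $\mathcal N=\{(x_i,y_j):0\le i\le m,\,0\le j\le n\}$ with $x_0<x_1<\dots<x_m=x_0+1$ and $y_0<y_1<\dots<y_n=y_0+1$. The space $H_1^{(2)}$ consists of all functions $g$, 1-periodic in both variables, such that $v_1^{(2)}(g)<\infty$ and, for every $x\in\mathbb{R}$ and every $y\in\mathbb{R}$, the sections $g(x,\cdot)$ and $g(\cdot,y)$ belong to $V_1$. *)

theory Defs
  imports "HOL-Analysis.Analysis"
begin

text \<open>
  Norms, moduli and variations are valued in \<^typ>\<open>ennreal\<close>, so that every supremum
  below is a true supremum, possibly infinite.
\<close>

definition periodic1 :: "(real \<Rightarrow> real) \<Rightarrow> bool" where
  "periodic1 h \<longleftrightarrow> (\<forall>x. h (x + 1) = h x)"

definition periodic2 :: "(real \<times> real \<Rightarrow> real) \<Rightarrow> bool" where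
  "periodic2 f \<longleftrightarrow> (\<forall>x y. f (x + 1, y) = f (x, y) \<and> f (x, y + 1) = f (x, y))"

definition L1_norm :: "(real \<times> real \<Rightarrow> real) \<Rightarrow> ennreal" where
  "L1_norm f = (\<integral>\<^sup>+ z \<in> {0..1} \<times> {0..1}. ennreal \<bar>f z\<bar> \<partial>lebesgue)"

definition L1_periodic :: "(real \<times> real \<Rightarrow> real) set" where
  "L1_periodic = {f. f \<in> borel_measurable lebesgue \<and> periodic2 f \<and> L1_norm f < \<infinity>}"

definition mixed_diff ::
    "real \<Rightarrow> real \<Rightarrow> (real \<times> real \<Rightarrow> real) \<Rightarrow> real \<times> real \<Rightarrow> real" where
  "mixed_diff s t f = (\<lambda>(x, y). f (x + s, y + t) - f (x + s, y) - f (x, y + t) + f (x, y))"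

definition mixed_modulus :: "(real \<times> real \<Rightarrow> real) \<Rightarrow> real \<Rightarrow> real \<Rightarrow> ennreal" where
  "mixed_modulus f u v = (SUP (s, t) \<in> {0..u} \<times> {0..v}. L1_norm (mixed_diff s t f))"

text \<open>
  Only \<open>x 0, \<dots>, x n\<close> matter. The last condition forces \<open>n > 0\<close>, and \<open>x 0\<close> is arbitrary.
\<close>

definition period_partition :: "nat \<Rightarrow> (nat \<Rightarrow> real) \<Rightarrow> bool" where
  "period_partition n x \<longleftrightarrow> (\<forall>i<n. x i < x (Suc i)) \<and> x n = x 0 + 1"

definition variation1 :: "(real \<Rightarrow> real) \<Rightarrow> ennreal" where
  "variation1 h =
    Sup {ennreal (\<Sum>k<n. \<bar>h (x (Suc k)) - h (x k)\<bar>) | n x. period_partition n x}"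

definition V1 :: "(real \<Rightarrow> real) set" where
  "V1 = {h. periodic1 h \<and> variation1 h < \<infinity>}"

definition variation2 :: "(real \<times> real \<Rightarrow> real) \<Rightarrow> ennreal" where
  "variation2 g =
    Sup {ennreal (\<Sum>i<m. \<Sum>j<n. \<bar>g (x (Suc i), y (Suc j)) - g (x (Suc i), y j)
                                 - g (x i, y (Suc j)) + g (x i, y j)\<bar>)
        | m n x y. period_partition m x \<and> period_partition n y}"

definition H12 :: "(real \<times> real \<Rightarrow> real) set" where
  "H12 = {g. periodic2 g \<and> variation2 g < \<infinity> \<and>
             (\<forall>x. (\<lambda>y. g (x, y)) \<in> V1) \<and> (\<forall>y. (\<lambda>x. g (x, y)) \<in> V1)}"

end

theory Submission
  imports Defs
begin

text \<open>
  Let \<open>R\<close> be the supremum of \<open>mixed_modulus f u v / (u * v)\<close>, which is finite by assumption. The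
  averages \<open>F h\<close> of \<open>f\<close> over squares of side \<open>h\<close> have mixed variation at most \<open>R\<close>: since increments
  and averages commute, the increment of \<open>F h\<close> over a rectangle is \<open>1 / h\<^sup>2\<close> times the integral of
  \<open>mixed_diff h h f\<close> over it, and the rectangles of a net tile a period cell, so that their sum is at
  most \<open>L1_norm (mixed_diff h h f) / h\<^sup>2\<close> (\<open>variation2_steklov_mean_le\<close>).

  By Lebesgue's theorem \<open>F h\<close> tends to \<open>f\<close> almost everywhere. Fubini's theorem supplies a base point
  \<open>(x0, y0)\<close> such that there is convergence at this point and almost everywhere on the horizontal and
  the vertical line through it (\<open>generic_point\<close>). Subtracting functions of one variable, one may
  replace \<open>F h\<close> by a function that vanishes on these two lines and has the same mixed variation; the
  value at any point is then itself a mixed increment, so these functions are bounded by \<open>R\<close>. A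
  compactness argument (\<open>Helly_variation2\<close>) gives a pointwise cluster point \<open>g\<close>, defined everywhere,
  periodic, with mixed variation at most \<open>R\<close>. Since \<open>g\<close> vanishes on the two lines, its sections have
  bounded variation (\<open>H12_I\<close>). At almost every point the normalized averages converge, and their
  limit is \<open>f (x, y) - f (x0, y) - f (x, y0) + f (x0, y0)\<close>: this is the decomposition.

  It remains to prove that \<open>R\<close> is at most the variation \<open>V\<close> of \<open>g\<close>. Mixed increments of \<open>f\<close> and \<open>g\<close>
  agree almost everywhere. Averaging the sums of \<open>g\<close> over all translates of the uniform net of mesh
  \<open>1 / N\<close> shows that the increment of \<open>f\<close> with both steps \<open>1 / N\<close> has norm at most \<open>V / N\<^sup>2\<close>
  (\<open>mixed_diff_norm_grid_le_variation2\<close>). The norm is subadditive in each step, which yields the bound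
  \<open>V * s * t\<close> for all steps that are multiples of \<open>1 / N\<close>, and the assumption on the modulus makes
  the norm continuous enough in the steps to reach all \<open>s\<close> and \<open>t\<close>
  (\<open>mixed_diff_norm_le_of_grid\<close>).
\<close>

section \<open>Locally integrable and periodic functions\<close>

definition locally_integrable :: "(real \<times> real \<Rightarrow> real) \<Rightarrow> bool" where
  "locally_integrable f \<longleftrightarrow> (\<forall>a b. f absolutely_integrable_on cbox a b)"

lemma locally_integrable_shift:
  assumes "locally_integrable f"
  shows "locally_integrable (\<lambda>z. f (z + w))"
  unfolding locally_integrable_def absolutely_integrable_on_def
proof (intro allI conjI)
  fix a b :: "real \<times> real"
  have *: "f absolutely_integrable_on cbox (a + w) (b + w)"
    using assms unfolding locally_integrable_def by iprover
  show "(\<lambda>z. f (z + w)) integrable_on cbox a b"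
    using * integrable_shift_cbox_iff[of f w "a + w" "b + w"]
    by (simp add: absolutely_integrable_on_def)
  show "(\<lambda>z. norm (f (z + w))) integrable_on cbox a b"
    using * integrable_shift_cbox_iff[of "\<lambda>z. norm (f z)" w "a + w" "b + w"]
    by (simp add: absolutely_integrable_on_def)
qed

lemma locally_integrable_intros:
  assumes "locally_integrable f"
  shows "locally_integrable (\<lambda>z. \<bar>f z\<bar>)"
    and "locally_integrable g \<Longrightarrow> locally_integrable (\<lambda>z. f z + g z)"
    and "locally_integrable g \<Longrightarrow> locally_integrable (\<lambda>z. f z - g z)"
  using assms set_integrable_abs[of lebesgue _ f]
  by (auto simp: locally_integrable_def intro!: set_integral_add set_integral_diff)

lemma locally_integrable_integrable:
  "locally_integrable f \<Longrightarrow> f integrable_on cbox a b"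
  unfolding locally_integrable_def absolutely_integrable_on_def by iprover

lemma mixed_diff_shift:
  "mixed_diff s t f = (\<lambda>z. f (z + (s, t)) - f (z + (s, 0)) - f (z + (0, t)) + f z)"
  by (auto simp: mixed_diff_def)

lemma locally_integrable_mixed_diff:
  "locally_integrable f \<Longrightarrow> locally_integrable (mixed_diff s t f)"
  unfolding mixed_diff_shift by (intro locally_integrable_intros locally_integrable_shift)

lemma L1_norm_eq_integral:
  assumes "locally_integrable f"
  shows "L1_norm f = ennreal (integral (cbox (0, 0) (1, 1)) (\<lambda>z. \<bar>f z\<bar>))"
proof -
  have "(\<lambda>z. \<bar>f z\<bar>) integrable_on cbox (0, 0) (1, 1)"
    using assms by (intro locally_integrable_integrable locally_integrable_intros)
  then have "((\<lambda>z. \<bar>f z\<bar>) has_integral integral (cbox (0, 0) (1, 1)) (\<lambda>z. \<bar>f z\<bar>)) (cbox (0, 0) (1, 1))"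
    by (rule integrable_integral)
  from nn_integral_has_integral_lebesgue'[OF _ this] show ?thesis
    by (simp add: L1_norm_def nn_integral_completion cbox_Pair_eq)
qed

lemma periodic1_of_int:
  assumes "periodic1 h"
  shows "h (x + of_int k) = h x"
proof (induction k rule: int_induct[of _ 0])
  case (step1 i)
  then show ?case using assms[unfolded periodic1_def, rule_format, of "x + of_int i"]
    by (simp add: add.assoc)
next
  case (step2 i)
  then show ?case using assms[unfolded periodic1_def, rule_format, of "x + of_int (i - 1)"]
    by (simp add: algebra_simps)
qed simp

lemma periodic2_sections:
  assumes "periodic2 f"
  shows "periodic1 (\<lambda>x. f (x, y))" "periodic1 (\<lambda>y. f (x, y))"
  using assms by (auto simp: periodic1_def periodic2_def)

lemma periodic2_of_int:
  assumes "periodic2 f"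
  shows "f (z + (of_int i, of_int j)) = f z"
  using periodic1_of_int[OF periodic2_sections(1)[OF assms]]
    periodic1_of_int[OF periodic2_sections(2)[OF assms]]
  by (cases z) simp

text \<open>
  Every bounded rectangle is covered by finitely many integer translates of the unit square, and
  periodicity carries integrability from the unit square to each of them.
\<close>
lemma locally_integrable_L1_periodic:
  assumes f: "f \<in> L1_periodic"
  shows "locally_integrable f"
  unfolding locally_integrable_def
proof (intro allI)
  fix a b :: "real \<times> real"
  obtain a1 a2 b1 b2 where ab: "a = (a1, a2)" "b = (b1, b2)" by (cases a, cases b)
  have per: "periodic2 f" and m: "f \<in> borel_measurable lebesgue" and fin: "L1_norm f < \<infinity>"
    using f by (auto simp: L1_periodic_def)
  have unit: "f absolutely_integrable_on cbox (0, 0) (1, 1)"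
    unfolding set_integrable_def
  proof (rule integrableI_bounded)
    show "(\<lambda>x. indicator (cbox (0, 0) (1, 1)) x *\<^sub>R f x) \<in> borel_measurable lebesgue"
      using m by (intro borel_measurable_scaleR borel_measurable_indicator) auto
    have "(\<integral>\<^sup>+ x. ennreal (norm (indicator (cbox (0, 0) (1, 1)) x *\<^sub>R f x)) \<partial>lebesgue) = L1_norm f"
      unfolding L1_norm_def
      by (intro nn_integral_cong) (auto simp: cbox_Pair_eq indicator_def)
    then show "(\<integral>\<^sup>+ x. ennreal (norm (indicator (cbox (0, 0) (1, 1)) x *\<^sub>R f x)) \<partial>lebesgue) < \<infinity>"
      using fin by simp
  qed
  have cell: "f absolutely_integrable_on cbox (of_int i, of_int j) (of_int i + 1, of_int j + 1)" for i j :: int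
  proof -
    have eq: "f (z + (- of_int i, - of_int j)) = f z" for z
      using periodic2_of_int[OF per, of z "-i" "-j"] by simp
    show ?thesis
      using unit integrable_shift_cbox_iff[of f "(- of_int i, - of_int j)" "(0, 0)" "(1, 1)"]
       integrable_shift_cbox_iff[of "\<lambda>z. norm (f z)" "(- of_int i, - of_int j)" "(0, 0)" "(1, 1)"]
      by (simp add: absolutely_integrable_on_def eq add.commute)
  qed
  let ?I = "{\<lfloor>a1\<rfloor>..\<lfloor>b1\<rfloor>} \<times> {\<lfloor>a2\<rfloor>..\<lfloor>b2\<rfloor>}"
  let ?U = "\<Union>(i, j)\<in>?I. cbox (real_of_int i, real_of_int j) (of_int i + 1, of_int j + 1)"
  have cells: "f absolutely_integrable_on ?U"
    using cell by (intro set_integrable_UN) auto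
  have cover: "cbox a b \<subseteq> ?U"
  proof
    fix z assume "z \<in> cbox a b"
    then obtain x y where z: "z = (x, y)" "a1 \<le> x" "x \<le> b1" "a2 \<le> y" "y \<le> b2"
      by (cases z) (auto simp: ab cbox_Pair_eq)
    then have "(\<lfloor>x\<rfloor>, \<lfloor>y\<rfloor>) \<in> ?I" by (auto intro: floor_mono)
    moreover have "z \<in> cbox (real_of_int \<lfloor>x\<rfloor>, real_of_int \<lfloor>y\<rfloor>) (of_int \<lfloor>x\<rfloor> + 1, of_int \<lfloor>y\<rfloor> + 1)"
      by (auto simp: z cbox_Pair_eq) 
    ultimately show "z \<in> ?U" by blast
  qed
  show "f absolutely_integrable_on cbox a b"
    by (rule set_integrable_subset[OF cells _ cover]) simp
qed

section \<open>Integrals over rectangles\<close>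

definition rect_integral :: "(real \<times> real \<Rightarrow> real) \<Rightarrow> real \<Rightarrow> real \<Rightarrow> real \<Rightarrow> real \<Rightarrow> real" where
  "rect_integral f a b c d = integral (cbox (a, c) (b, d)) f"

lemma rect_integral_split:
  assumes f: "locally_integrable f"
  shows "a \<le> m \<Longrightarrow> m \<le> b \<Longrightarrow> rect_integral f a b c d = rect_integral f a m c d + rect_integral f m b c d"
    and "c \<le> m \<Longrightarrow> m \<le> d \<Longrightarrow> rect_integral f a b c d = rect_integral f a b c m + rect_integral f a b m d"
proof -
  have B: "(1, 0) \<in> (Basis :: (real \<times> real) set)" "(0, 1) \<in> (Basis :: (real \<times> real) set)"
    by (auto simp: Basis_prod_def)
  note i = locally_integrable_integrable[OF f]
  { assume "a \<le> m" "m \<le> b"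
    then have "cbox (a, c) (b, d) \<inter> {x. x \<bullet> (1, 0) \<le> m} = cbox (a, c) (m, d)"
       "cbox (a, c) (b, d) \<inter> {x. m \<le> x \<bullet> (1, 0)} = cbox (m, c) (b, d)"
      by (auto simp: cbox_Pair_eq)
    then show "rect_integral f a b c d = rect_integral f a m c d + rect_integral f m b c d"
      using integral_split[OF i B(1), of "(a, c)" "(b, d)" m] by (simp add: rect_integral_def) }
  { assume "c \<le> m" "m \<le> d"
    then have "cbox (a, c) (b, d) \<inter> {x. x \<bullet> (0, 1) \<le> m} = cbox (a, c) (b, m)"
       "cbox (a, c) (b, d) \<inter> {x. m \<le> x \<bullet> (0, 1)} = cbox (a, m) (b, d)"
      by (auto simp: cbox_Pair_eq)
    then show "rect_integral f a b c d = rect_integral f a b c m + rect_integral f a b m d"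
      using integral_split[OF i B(2), of "(a, c)" "(b, d)" m] by (simp add: rect_integral_def) }
qed

text \<open>
  Measured from a fixed corner \<open>(p, q)\<close>, the integral over a rectangle is the mixed difference of
  its primitive. Through this formula, identities between integrals over overlapping rectangles
  become linear identities between values of the primitive.
\<close>
lemma rect_integral_corner:
  assumes f: "locally_integrable f" and "p \<le> a" "a \<le> b" "q \<le> c" "c \<le> d"
  shows "rect_integral f a b c d =
    rect_integral f p b q d - rect_integral f p a q d - rect_integral f p b q c + rect_integral f p a q c"
  using assms rect_integral_split(1)[OF f, of p a b q d] rect_integral_split(1)[OF f, of p a b q c]
    rect_integral_split(2)[OF f, of q c d a b] by simp

lemma rect_integral_shift:
  "rect_integral (\<lambda>z. f (z + (s, t))) a b c d = rect_integral f (a + s) (b + s) (c + t) (d + t)"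
  using integral_shift_cbox[of "(a + s, c + t)" "(s, t)" "(b + s, d + t)" f]
  by (simp add: rect_integral_def)

lemma rect_integral_add:
  "locally_integrable f \<Longrightarrow> locally_integrable g \<Longrightarrow>
    rect_integral (\<lambda>z. f z + g z) a b c d = rect_integral f a b c d + rect_integral g a b c d"
  "locally_integrable f \<Longrightarrow> locally_integrable g \<Longrightarrow>
    rect_integral (\<lambda>z. f z - g z) a b c d = rect_integral f a b c d - rect_integral g a b c d"
  by (auto simp: rect_integral_def integral_add integral_diff locally_integrable_integrable)

lemma rect_integral_mixed_diff:
  assumes f: "locally_integrable f"
  shows "rect_integral (mixed_diff h k f) a b c d =
    rect_integral f (a + h) (b + h) (c + k) (d + k) - rect_integral f (a + h) (b + h) c d
    - rect_integral f a b (c + k) (d + k) + rect_integral f a b c d"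
proof -
  note li = f locally_integrable_shift[OF f] locally_integrable_intros
  show ?thesis
    unfolding mixed_diff_shift
    by (simp add: rect_integral_add li rect_integral_shift)
qed

text \<open>
  Increments and averaging commute: an increment of the moving integral of \<open>f\<close> is the integral of an
  increment of \<open>f\<close>, with the roles of step and window exchanged. Both sides are the same alternating
  sum of sixteen values of the primitive with corner \<open>(x, y)\<close>.
\<close>
lemma mixed_diff_rect_integral:
  assumes f: "locally_integrable f" and "0 \<le> s" "0 \<le> t" "0 \<le> h" "0 \<le> k"
  shows "mixed_diff s t (\<lambda>(x, y). rect_integral f x (x + h) y (y + k)) (x, y) =
    rect_integral (mixed_diff h k f) x (x + s) y (y + t)"
proof -
  define G where "G u v = rect_integral f x u y v" for u v
  have G: "rect_integral f a b c d = G b d - G a d - G b c + G a c"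
    if "x \<le> a" "a \<le> b" "y \<le> c" "c \<le> d" for a b c d
    unfolding G_def using rect_integral_corner[OF f] that by blast
  have z: "G x v = 0" "G u y = 0" for u v
    unfolding G_def using rect_integral_split[OF f, of x x x y v] rect_integral_split(2)[OF f, of y y y x u]
    by simp_all
  show ?thesis
    unfolding rect_integral_mixed_diff[OF f]
    using assms by (simp add: mixed_diff_def G z add.commute add.left_commute)
qed

lemma period_partition_mono:
  assumes "period_partition n x" "i \<le> j" "j \<le> n"
  shows "x i \<le> x j"
  using assms(2,3)
proof (induction j rule: dec_induct)
  case (step m)
  then show ?case using assms(1)[unfolded period_partition_def] by (auto simp: less_imp_le intro: order_trans[of _ "x m"])
qed simp

text \<open>
  A net cuts one period cell into rectangles; in terms of the primitive the sum telescopes in both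
  directions.
\<close>
lemma rect_integral_tiling:
  assumes f: "locally_integrable f" and x: "period_partition m x" and y: "period_partition n y"
  shows "(\<Sum>i<m. \<Sum>j<n. rect_integral f (x i) (x (Suc i)) (y j) (y (Suc j))) =
    rect_integral f (x 0) (x 0 + 1) (y 0) (y 0 + 1)"
proof -
  have *: "(\<Sum>j<n. rect_integral f a b (y j) (y (Suc j))) = rect_integral f a b (y 0) (y n)" for a b
  proof -
    have "rect_integral f a b (y j) (y (Suc j)) = rect_integral f a b (y 0) (y (Suc j)) - rect_integral f a b (y 0) (y j)"
      if "j < n" for j
      using that rect_integral_split(2)[OF f, of "y 0" "y j" "y (Suc j)" a b] period_partition_mono[OF y] by simp
    then have "(\<Sum>j<n. rect_integral f a b (y j) (y (Suc j))) = (\<Sum>j<n. rect_integral f a b (y 0) (y (Suc j)) - rect_integral f a b (y 0) (y j))"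
      by simp
    also have "\<dots> = rect_integral f a b (y 0) (y n) - rect_integral f a b (y 0) (y 0)"
      by (rule sum_lessThan_telescope)
    finally show ?thesis using rect_integral_split(2)[OF f, of "y 0" "y 0" "y 0" a b] by simp
  qed
  have "rect_integral f (x i) (x (Suc i)) c d = rect_integral f (x 0) (x (Suc i)) c d - rect_integral f (x 0) (x i) c d"
    if "i < m" for i c d
    using that rect_integral_split(1)[OF f, of "x 0" "x i" "x (Suc i)" c d] period_partition_mono[OF x] by simp
  then have "(\<Sum>i<m. rect_integral f (x i) (x (Suc i)) (y 0) (y n))
    = (\<Sum>i<m. rect_integral f (x 0) (x (Suc i)) (y 0) (y n) - rect_integral f (x 0) (x i) (y 0) (y n))" by simp
  also have "\<dots> = rect_integral f (x 0) (x m) (y 0) (y n) - rect_integral f (x 0) (x 0) (y 0) (y n)"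
    by (rule sum_lessThan_telescope)
  finally show ?thesis
    using x y rect_integral_split(1)[OF f, of "x 0" "x 0" "x 0" "y 0" "y n"]
    by (simp add: * period_partition_def)
qed

text \<open>
  After an integer shift the corner lies in the unit square. The strip by which the cell then
  sticks out is a translate, by one period, of the strip that it misses.
\<close>
lemma rect_integral_period:
  assumes f: "locally_integrable f" and p: "periodic2 f"
  shows "rect_integral f a (a + 1) b (b + 1) = rect_integral f 0 1 0 1"
proof -
  have int: "rect_integral f (a + of_int i) (b + of_int i) (c + of_int j) (d + of_int j) = rect_integral f a b c d"
    for a b c d i j
    using rect_integral_shift[of f "of_int i" "of_int j" a b c d] by (simp add: periodic2_of_int[OF p])
  have x: "rect_integral f a (a + 1) c d = rect_integral f 0 1 c d" if "0 \<le> a" "a \<le> 1" for a c d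
    using that rect_integral_split(1)[OF f, of a 1 "a + 1" c d] rect_integral_split(1)[OF f, of 0 a 1 c d] 
      int[of 0 1 a c 0 d] by (simp add: add.commute)
  have y: "rect_integral f a b c (c + 1) = rect_integral f a b 0 1" if "0 \<le> c" "c \<le> 1" for a b c
    using that rect_integral_split(2)[OF f, of c 1 "c + 1" a b] rect_integral_split(2)[OF f, of 0 c 1 a b] 
      int[of a 0 b 0 1 c] by (simp add: add.commute)
  have "rect_integral f a (a + 1) b (b + 1) = rect_integral f (frac a) (frac a + 1) (frac b) (frac b + 1)"
    using int[of "frac a" "\<lfloor>a\<rfloor>" "frac a + 1" "frac b" "\<lfloor>b\<rfloor>" "frac b + 1"]
    by (simp add: frac_def)
  then show ?thesis by (simp add: x y frac_ge_0 frac_lt_1 less_imp_le)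
qed

section \<open>Sections and nets of functions of bounded mixed variation\<close>

definition rect_diff :: "(real \<times> real \<Rightarrow> real) \<Rightarrow> real \<Rightarrow> real \<Rightarrow> real \<Rightarrow> real \<Rightarrow> real" where
  "rect_diff g a b c d = g (b, d) - g (b, c) - g (a, d) + g (a, c)"

definition net_sum :: "(real \<times> real \<Rightarrow> real) \<Rightarrow> nat \<Rightarrow> (nat \<Rightarrow> real) \<Rightarrow> nat \<Rightarrow> (nat \<Rightarrow> real) \<Rightarrow> real" where
  "net_sum g m x n y = (\<Sum>i<m. \<Sum>j<n. \<bar>rect_diff g (x i) (x (Suc i)) (y j) (y (Suc j))\<bar>)"

lemma variation2_eq_Sup_net_sum:
  "variation2 g = Sup {ennreal (net_sum g m x n y) | m n x y. period_partition m x \<and> period_partition n y}"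
  by (simp add: variation2_def net_sum_def rect_diff_def)

lemma net_sum_le_variation2:
  "period_partition m x \<Longrightarrow> period_partition n y \<Longrightarrow> ennreal (net_sum g m x n y) \<le> variation2 g"
  unfolding variation2_eq_Sup_net_sum by (intro Sup_upper) blast

lemma variation2_leI:
  assumes "\<And>m n x y. period_partition m x \<Longrightarrow> period_partition n y \<Longrightarrow> ennreal (net_sum g m x n y) \<le> L"
  shows "variation2 g \<le> L"
  unfolding variation2_eq_Sup_net_sum using assms by (intro Sup_least) blast

lemma net_sum_swap: "net_sum (\<lambda>z. g (prod.swap z)) n y m x = net_sum g m x n y"
  unfolding net_sum_def rect_diff_def
  by (subst sum.swap) (simp add: algebra_simps)

lemma variation2_swap: "variation2 (\<lambda>z. g (prod.swap z)) = variation2 g"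
proof -
  have *: "variation2 (\<lambda>z. h (prod.swap z)) \<le> variation2 h" for h
    using net_sum_swap[of h] by (intro variation2_leI) (metis net_sum_le_variation2)
  have "variation2 g \<le> variation2 (\<lambda>z. g (prod.swap z))"
    using *[of "\<lambda>z. g (prod.swap z)"] by simp
  with *[of g] show ?thesis by simp
qed

lemma period_partition_three_points:
  assumes "a < b" "b < a + 1"
  shows "period_partition 2 (\<lambda>i. if i = 0 then a else if i = 1 then b else a + 1)"
  using assms by (auto simp: period_partition_def less_2_cases_iff)

text \<open>
  If \<open>g\<close> vanishes on the line over \<open>x0\<close>, then by periodicity it vanishes on the lines over \<open>a\<close>
  and \<open>a + 1\<close>, where \<open>a\<close> is the last integer translate of \<open>x0\<close> that does not exceed \<open>x\<close>. The increments of
  the section at \<open>x\<close> are therefore mixed increments of \<open>g\<close> over the strip from \<open>a\<close> to \<open>x\<close>, which is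
  part of the net with abscissas \<open>a\<close>, \<open>x\<close>, \<open>a + 1\<close>.
\<close>
lemma section_variation_le:
  assumes g: "periodic2 g" and 0: "\<And>y. g (x0, y) = 0"
  shows "variation1 (\<lambda>y. g (x, y)) \<le> variation2 g"
  unfolding variation1_def
proof (intro Sup_least, clarify)
  fix n y assume y: "period_partition n y"
  define a where "a = x0 + of_int \<lfloor>x - x0\<rfloor>"
  have a0: "g (a, y) = 0" "g (a + 1, y) = 0" for y
    using periodic1_of_int[OF periodic2_sections(1)[OF g, of y], of x0 "\<lfloor>x - x0\<rfloor>"]
      periodic1_of_int[OF periodic2_sections(1)[OF g, of y], of x0 "\<lfloor>x - x0\<rfloor> + 1"] 0
    by (auto simp: a_def add.assoc)
  have a: "a \<le> x" "x < a + 1" unfolding a_def by linarith+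
  show "ennreal (\<Sum>k<n. \<bar>g (x, y (Suc k)) - g (x, y k)\<bar>) \<le> variation2 g"
  proof (cases "a = x")
    case True
    then show ?thesis using a0 by simp
  next
    case False
    let ?x = "\<lambda>i::nat. if i = 0 then a else if i = 1 then x else a + 1"
    have "(\<Sum>k<n. \<bar>g (x, y (Suc k)) - g (x, y k)\<bar>) \<le> net_sum g 2 ?x n y"
      by (simp add: net_sum_def rect_diff_def a0 numeral_2_eq_2 sum_nonneg)
    then show ?thesis
      using net_sum_le_variation2[OF period_partition_three_points y, of a x g] a False
      by (meson ennreal_leI order.trans order_le_less)
  qed
qed

text \<open>
  The value \<open>h y\<close> is the increment of \<open>h\<close> from the last integer translate of \<open>y0\<close> that does not exceed \<open>y\<close>, where \<open>h\<close>
  vanishes as well.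
\<close>
lemma abs_le_variation1:
  assumes h: "periodic1 h" and 0: "h y0 = 0"
  shows "ennreal \<bar>h y\<bar> \<le> variation1 h"
proof -
  define a where "a = y0 + of_int \<lfloor>y - y0\<rfloor>"
  have a0: "h a = 0" "h (a + 1) = 0"
    using periodic1_of_int[OF h, of y0 "\<lfloor>y - y0\<rfloor>"] periodic1_of_int[OF h, of y0 "\<lfloor>y - y0\<rfloor> + 1"] 0
    by (auto simp: a_def add.assoc)
  have a: "a \<le> y" "y < a + 1" unfolding a_def by linarith+
  show ?thesis
  proof (cases "a = y")
    case True
    then show ?thesis using a0 by simp
  next
    case False
    let ?y = "\<lambda>i::nat. if i = 0 then a else if i = 1 then y else a + 1"
    have p: "period_partition 2 ?y" using a False by (intro period_partition_three_points) auto
    have "\<bar>h y\<bar> \<le> (\<Sum>k<2. \<bar>h (?y (Suc k)) - h (?y k)\<bar>)"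
      by (simp add: numeral_2_eq_2 a0)
    moreover have "ennreal (\<Sum>k<2. \<bar>h (?y (Suc k)) - h (?y k)\<bar>) \<le> variation1 h"
      unfolding variation1_def by (intro Sup_upper CollectI exI conjI, rule refl, rule p)
    ultimately show ?thesis by (meson ennreal_leI order.trans)
  qed
qed

lemma periodic2_swap: "periodic2 g \<Longrightarrow> periodic2 (\<lambda>z. g (prod.swap z))"
  by (auto simp: periodic2_def)

text \<open>
  Finite mixed variation controls all sections as soon as \<open>g\<close> vanishes on one line in each direction,
  which a suitable normalization can always achieve.
\<close>
lemma H12_I:
  assumes g: "periodic2 g" and v: "variation2 g < \<infinity>"
    and 0: "\<And>y. g (x0, y) = 0" "\<And>x. g (x, y0) = 0"
  shows "g \<in> H12"
proof -
  have "variation1 (\<lambda>y. g (x, y)) < \<infinity>" for x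
    using section_variation_le[OF g 0(1), of x] v by (simp add: order.strict_trans1)
  moreover have "variation1 (\<lambda>x. g (x, y)) < \<infinity>" for y
    using section_variation_le[OF periodic2_swap[OF g], of y0 y] 0(2) v
    by (simp add: variation2_swap order.strict_trans1)
  ultimately show ?thesis
    using g v periodic2_sections[OF g] by (simp add: H12_def V1_def)
qed

lemma abs_le_variation2:
  assumes g: "periodic2 g" and 0: "\<And>y. g (x0, y) = 0" "\<And>x. g (x, y0) = 0"
  shows "ennreal \<bar>g z\<bar> \<le> variation2 g"
proof -
  have "ennreal \<bar>g (fst z, snd z)\<bar> \<le> variation1 (\<lambda>y. g (fst z, y))"
    using 0(2) by (intro abs_le_variation1[OF periodic2_sections(2)[OF g]])
  also have "\<dots> \<le> variation2 g" by (rule section_variation_le[OF g 0(1)])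
  finally show ?thesis by simp
qed

section \<open>A Helly selection principle for the mixed variation\<close>

text \<open>
  A uniformly bounded sequence of functions lives in a product of compact intervals, which is compact
  by Tychonoff's theorem. It therefore has a cluster point \<open>h\<close>, and the filter \<open>G\<close> on the function
  space refines the sequence and converges to \<open>h\<close> at every point. Unlike a subsequence, this filter
  needs no diagonal argument, although the domain may be uncountable.
\<close>
lemma pointwise_cluster_function:
  fixes g :: "nat \<Rightarrow> 'a \<Rightarrow> real"
  assumes "\<And>n z. \<bar>g n z\<bar> \<le> L"
  obtains G h where "G \<noteq> bot" "G \<le> filtermap g sequentially"
    "\<And>z. ((\<lambda>\<phi>. \<phi> z) \<longlongrightarrow> h z) G"
proof -
  let ?K = "PiE (UNIV :: 'a set) (\<lambda>_. {- L..L})"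
  have "compactin (product_topology (\<lambda>_. euclidean) UNIV) ?K"
    unfolding compactin_PiE by simp
  then have "compact ?K" by (simp add: euclidean_product_topology)
  moreover have "filtermap g sequentially \<noteq> bot" by (simp add: filtermap_bot_iff)
  moreover have "eventually (\<lambda>\<phi>. \<phi> \<in> ?K) (filtermap g sequentially)"
    using assms by (simp add: eventually_filtermap PiE_UNIV_domain Pi_iff abs_le_iff minus_le_iff)
  ultimately obtain h where h: "inf (nhds h) (filtermap g sequentially) \<noteq> bot"
    unfolding compact_filter by blast
  have "((\<lambda>\<phi>. \<phi> z) \<longlongrightarrow> h z) (nhds h)" for z
  proof -
    have "((\<lambda>\<phi>. \<phi> z) \<longlongrightarrow> h z) (at h)"
      using continuous_on_product_coordinates[of z] unfolding continuous_on_def by blast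
    then show ?thesis by (rule iffD1[OF tendsto_at_iff_tendsto_nhds])
  qed
  then have "((\<lambda>\<phi>. \<phi> z) \<longlongrightarrow> h z) (inf (nhds h) (filtermap g sequentially))" for z
    by (rule tendsto_mono[rotated]) simp
  with h show ?thesis by (intro that[of "inf (nhds h) (filtermap g sequentially)" h]) auto
qed

text \<open>
  For a fixed net the sum depends on finitely many values of the function, so it is continuous under
  pointwise convergence and any bound on the mixed variation passes to the limit. The same holds for
  periodicity. At points where the sequence itself converges, the cluster point has no choice.
\<close>
lemma Helly_variation2:
  fixes g :: "nat \<Rightarrow> real \<times> real \<Rightarrow> real"
  assumes per: "\<And>n. periodic2 (g n)" and v: "\<And>n. variation2 (g n) \<le> ennreal L"
    and b: "\<And>n z. \<bar>g n z\<bar> \<le> M"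
  obtains h where "periodic2 h" "variation2 h \<le> ennreal L"
    "\<And>z l. (\<lambda>n. g n z) \<longlonglongrightarrow> l \<Longrightarrow> h z = l"
proof -
  obtain G h where G: "G \<noteq> bot" "G \<le> filtermap g sequentially"
    and lim: "\<And>z. ((\<lambda>\<phi>. \<phi> z) \<longlongrightarrow> h z) G"
    using pointwise_cluster_function[of g M, OF b] by blast
  have ev: "eventually P G" if "\<And>n. P (g n)" for P
    using G(2) that by (intro filter_leD[OF G(2)]) (simp add: eventually_filtermap)
  have "periodic2 h"
    unfolding periodic2_def
  proof (intro allI conjI)
    fix x y
    have "((\<lambda>\<phi>. \<phi> (x, y)) \<longlongrightarrow> h (x + 1, y)) G" "((\<lambda>\<phi>. \<phi> (x, y)) \<longlongrightarrow> h (x, y + 1)) G"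
      using per by (auto intro!: Lim_transform_eventually[OF lim] ev simp: periodic2_def)
    then show "h (x + 1, y) = h (x, y)" "h (x, y + 1) = h (x, y)"
      using tendsto_unique[OF G(1) _ lim] by blast+
  qed
  moreover have "variation2 h \<le> ennreal L"
  proof (rule variation2_leI)
    fix m n x y assume xy: "period_partition m x" "period_partition n y"
    have "net_sum (g k) m x n y \<le> max L 0" for k
      using order.trans[OF net_sum_le_variation2[OF xy, of "g k"] v]
      by (cases "L \<ge> 0") (auto simp: ennreal_le_iff ennreal_neg)
    then have "eventually (\<lambda>\<phi>. net_sum \<phi> m x n y \<le> max L 0) G" by (rule ev)
    moreover have "((\<lambda>\<phi>. net_sum \<phi> m x n y) \<longlongrightarrow> net_sum h m x n y) G"
      unfolding net_sum_def rect_diff_def by (intro tendsto_intros lim)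
    ultimately have "net_sum h m x n y \<le> max L 0"
      using tendsto_upperbound G(1) by blast
    then show "ennreal (net_sum h m x n y) \<le> ennreal L"
      by (metis ennreal_leI max.commute max_def ennreal_neg nle_le)
  qed
  moreover have "h z = l" if "(\<lambda>n. g n z) \<longlonglongrightarrow> l" for z l
  proof -
    have "((\<lambda>\<phi>. \<phi> z) \<longlongrightarrow> l) (filtermap g sequentially)"
      using that by (simp add: filterlim_filtermap)
    then show ?thesis using tendsto_unique[OF G(1) lim] tendsto_mono[OF G(2)] by blast
  qed
  ultimately show ?thesis by (rule that)
qed

section \<open>Steklov means\<close>

definition steklov_mean :: "real \<Rightarrow> (real \<times> real \<Rightarrow> real) \<Rightarrow> real \<times> real \<Rightarrow> real" where
  "steklov_mean h f = (\<lambda>(x, y). rect_integral f x (x + h) y (y + h) / h\<^sup>2)"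

lemma periodic2_steklov_mean:
  assumes "periodic2 f"
  shows "periodic2 (steklov_mean h f)"
proof -
  have *: "rect_integral f (a + 1) (b + 1) c d = rect_integral f a b c d"
    "rect_integral f a b (c + 1) (d + 1) = rect_integral f a b c d" for a b c d
    using rect_integral_shift[of f 1 0 a b c d] rect_integral_shift[of f 0 1 a b c d]
      periodic2_of_int[OF assms, of _ 1 0] periodic2_of_int[OF assms, of _ 0 1] by simp_all
  from *(1)[of x "x + h" y "y + h" for x y] *(2)[of x "x + h" y "y + h" for x y]
  show ?thesis
    by (simp add: periodic2_def steklov_mean_def ac_simps)
qed

lemma periodic2_mixed_diff: "periodic2 f \<Longrightarrow> periodic2 (mixed_diff s t f)"
  unfolding periodic2_def mixed_diff_def 
  by (simp add: add.assoc add.left_commute add.commute[of 1]) (simp add: add.assoc[symmetric])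

lemma L1_norm_eq_rect_integral:
  "locally_integrable f \<Longrightarrow> L1_norm f = ennreal (rect_integral (\<lambda>z. \<bar>f z\<bar>) 0 1 0 1)"
  by (simp add: L1_norm_eq_integral rect_integral_def)

lemma rect_integral_abs:
  assumes "locally_integrable f"
  shows "\<bar>rect_integral f a b c d\<bar> \<le> rect_integral (\<lambda>z. \<bar>f z\<bar>) a b c d"
  using integral_norm_bound_integral[of f "cbox (a, c) (b, d)" "\<lambda>z. \<bar>f z\<bar>"]
   locally_integrable_integrable[OF assms] locally_integrable_integrable[OF locally_integrable_intros(1)[OF assms]]
  by (simp add: rect_integral_def)

text \<open>
  Up to the factor \<open>h\<^sup>2\<close>, the mixed increment of the average over a rectangle is the integral of
  \<open>mixed_diff h h f\<close> over that rectangle (\<open>mixed_diff_rect_integral\<close>). A net tiles a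
  period cell, so the absolute increments add up to at most the integral of \<open>\<bar>mixed_diff h h f\<bar>\<close> over
  the cell.
\<close>
lemma variation2_steklov_mean_le:
  assumes f: "locally_integrable f" "periodic2 f" and h: "0 < h"
  shows "variation2 (steklov_mean h f) \<le> L1_norm (mixed_diff h h f) / ennreal (h * h)"
proof (rule variation2_leI)
  fix m n x y assume x: "period_partition m x" and y: "period_partition n y"
  let ?D = "mixed_diff h h f"
  let ?F = "\<lambda>(x, y). rect_integral f x (x + h) y (y + h)"
  have li: "locally_integrable ?D" "locally_integrable (\<lambda>z. \<bar>?D z\<bar>)"
    using f by (auto intro: locally_integrable_intros locally_integrable_mixed_diff)
  have per: "periodic2 (\<lambda>z. \<bar>?D z\<bar>)"
    using periodic2_mixed_diff[OF f(2), of h h] by (simp add: periodic2_def)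
  have le: "\<bar>rect_diff (steklov_mean h f) a b c d\<bar> \<le> rect_integral (\<lambda>z. \<bar>?D z\<bar>) a b c d / (h * h)"
    if "a \<le> b" "c \<le> d" for a b c d
  proof -
    have "rect_diff (steklov_mean h f) a b c d = mixed_diff (b - a) (d - c) ?F (a, c) / (h * h)"
      by (simp add: rect_diff_def steklov_mean_def mixed_diff_def power2_eq_square
          diff_divide_distrib add_divide_distrib)
    also have "\<dots> = rect_integral ?D a b c d / (h * h)"
      using mixed_diff_rect_integral[OF f(1), of "b - a" "d - c" h h a c] that h by simp
    finally show ?thesis
      using rect_integral_abs[OF li(1)] h by (simp add: abs_mult divide_right_mono)
  qed
  have "net_sum (steklov_mean h f) m x n y \<le>
      (\<Sum>i<m. \<Sum>j<n. rect_integral (\<lambda>z. \<bar>?D z\<bar>) (x i) (x (Suc i)) (y j) (y (Suc j)) / (h * h))"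
    unfolding net_sum_def using x y
    by (intro sum_mono le) (auto simp: period_partition_def less_imp_le)
  also have "\<dots> = rect_integral (\<lambda>z. \<bar>?D z\<bar>) 0 1 0 1 / (h * h)"
    unfolding sum_divide_distrib[symmetric] rect_integral_tiling[OF li(2) x y]
      rect_integral_period[OF li(2) per] ..
  finally show "ennreal (net_sum (steklov_mean h f) m x n y) \<le> L1_norm ?D / ennreal (h * h)"
    using h rect_integral_abs[OF li(2), of 0 1 0 1]
    by (simp add: L1_norm_eq_rect_integral li divide_ennreal ennreal_leI)
qed

text \<open>
  The normalization of \<open>g\<close> that vanishes on the lines through \<open>(x0, y0)\<close>. It differs from \<open>g\<close> by
  functions of one variable, to which mixed increments are blind.
\<close>
definition anchored :: "real \<Rightarrow> real \<Rightarrow> (real \<times> real \<Rightarrow> real) \<Rightarrow> real \<times> real \<Rightarrow> real" where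
  "anchored x0 y0 g = (\<lambda>(x, y). g (x, y) - g (x0, y) - g (x, y0) + g (x0, y0))"

lemma variation2_anchored: "variation2 (anchored x0 y0 g) = variation2 g"
  by (simp add: variation2_eq_Sup_net_sum net_sum_def rect_diff_def anchored_def algebra_simps)

lemma periodic2_anchored: "periodic2 g \<Longrightarrow> periodic2 (anchored x0 y0 g)"
  by (simp add: periodic2_def anchored_def)

section \<open>Almost every point in the plane\<close>

lemma AE_lborelE:
  assumes "AE z in lborel. P z"
  obtains N where "N \<in> null_sets lborel" "\<And>z. z \<notin> N \<Longrightarrow> P z"
proof -
  obtain N where "{z \<in> space lborel. \<not> P z} \<subseteq> N" "emeasure lborel N = 0" "N \<in> sets lborel"
    using assms by (rule AE_E)
  then show ?thesis by (intro that[of N] null_setsI) auto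
qed

lemma AE_lebesgue_shift:
  fixes w :: "'a::euclidean_space"
  assumes "AE z in lebesgue. P z"
  shows "AE z in lebesgue. P (z + w)"
proof -
  from assms have "AE z in lborel. P z" by (simp only: AE_completion_iff)
  then obtain N where N: "N \<in> null_sets lborel" "\<And>z. z \<notin> N \<Longrightarrow> P z"
    by (rule AE_lborelE) (rule that)
  have "AE z in lborel. z \<notin> {z. z - (- w) \<in> N}"
    by (intro AE_not_in null_sets_translation[OF N(1)])
  then have "AE z in lborel. P (z + w)"
    by (rule eventually_mono) (simp add: N(2))
  then show ?thesis by (rule AE_completion)
qed

lemma AE_lebesgue_Times:
  fixes P :: "'a::euclidean_space \<Rightarrow> bool" and Q :: "'b::euclidean_space \<Rightarrow> bool"
  assumes "AE x in lborel. P x" "AE y in lborel. Q y"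
  shows "AE (x, y) in lebesgue. P x \<and> Q y"
proof -
  obtain M where M: "M \<in> null_sets lborel" "\<And>x. x \<notin> M \<Longrightarrow> P x"
    using assms(1) by (rule AE_lborelE) (rule that)
  obtain N where N: "N \<in> null_sets lborel" "\<And>y. y \<notin> N \<Longrightarrow> Q y"
    using assms(2) by (rule AE_lborelE) (rule that)
  have "M \<times> UNIV \<in> null_sets (lborel \<Otimes>\<^sub>M (lborel :: 'b measure))"
    using M(1) by (intro null_setsI) (auto simp: null_sets_def lborel.emeasure_pair_measure_Times)
  moreover have "UNIV \<times> N \<in> null_sets ((lborel :: 'a measure) \<Otimes>\<^sub>M lborel)"
    using N(1) by (intro null_setsI) (auto simp: null_sets_def lborel.emeasure_pair_measure_Times)
  ultimately have "AE z in lborel. z \<notin> M \<times> UNIV \<union> UNIV \<times> N"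
    unfolding lborel_prod by (intro AE_not_in null_sets.Un)
  then have "AE (x, y) in lborel. P x \<and> Q y"
    by (rule eventually_mono) (auto intro: M(2) N(2))
  then show ?thesis by (rule AE_completion)
qed

text \<open>
  By Fubini's theorem almost every vertical line, and almost every horizontal line, meets the
  exceptional null set in a null set of the line. The base point \<open>(x0, y0)\<close> is chosen off the null set,
  as the intersection of two such lines.
\<close>
lemma generic_point:
  fixes P :: "real \<times> real \<Rightarrow> bool"
  assumes "AE z in lebesgue. P z"
  obtains x0 y0 where "P (x0, y0)" "AE (x, y) in lebesgue. P (x, y0) \<and> P (x0, y)"
proof -
  from assms have "AE z in lborel. P z" by (simp only: AE_completion_iff)
  then obtain N where N: "N \<in> null_sets lborel" and NP: "\<And>z. z \<notin> N \<Longrightarrow> P z"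
    by (rule AE_lborelE) (rule that)
  have "AE z in lborel \<Otimes>\<^sub>M lborel. z \<notin> N"
    unfolding lborel_prod using N by (rule AE_not_in)
  then have *: "AE x in lborel. AE y in lborel. (x, y) \<notin> N"
    by (rule lborel_pair.AE_pair)
  have "N \<in> sets (lborel \<Otimes>\<^sub>M lborel)" unfolding lborel_prod using N by (rule null_setsD2)
  moreover have "{z \<in> space (lborel \<Otimes>\<^sub>M lborel). (fst z, snd z) \<notin> N} = space (lborel \<Otimes>\<^sub>M lborel) - N"
    by auto
  ultimately have "{z \<in> space (lborel \<Otimes>\<^sub>M lborel). (fst z, snd z) \<notin> N} \<in> sets (lborel \<Otimes>\<^sub>M lborel)"
    by (simp only: sets.compl_sets)
  from lborel_pair.AE_commute[OF this] *
  have **: "AE y in lborel. AE x in lborel. (x, y) \<notin> N" by simp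
  have ne: "\<exists>x. Q x" if "AE x in lborel. Q x" for Q :: "real \<Rightarrow> bool"
  proof (rule ccontr)
    assume "\<nexists>x. Q x"
    then have "AE x in lborel::real measure. False" using that by simp
    then show False by (simp add: AE_iff_null emeasure_lborel_UNIV null_sets_def)
  qed
  obtain x0 where x0: "AE y in lborel. (x0, y) \<notin> N" using ne[OF *] by blast
  obtain y0 where y0: "AE x in lborel. (x, y0) \<notin> N" "(x0, y0) \<notin> N"
    using ne[OF AE_conjI[OF ** x0]] by blast
  have "AE (x, y) in lebesgue. (x, y0) \<notin> N \<and> (x0, y) \<notin> N"
    by (rule AE_lebesgue_Times[OF y0(1) x0])
  then have "AE (x, y) in lebesgue. P (x, y0) \<and> P (x0, y)"
    by (rule eventually_mono) (simp add: case_prod_beta NP)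
  moreover have "P (x0, y0)" using NP y0(2) by simp
  ultimately show ?thesis by (intro that)
qed

text \<open>
  Lebesgue's differentiation theorem, along squares that have the point as a corner.
\<close>
lemma steklov_mean_tendsto_AE:
  assumes f: "locally_integrable f"
  shows "AE z in lebesgue. (\<lambda>n. steklov_mean (inverse (real (Suc n))) f z) \<longlonglongrightarrow> f z"
proof -
  have One: "(\<Sum>(Basis :: (real \<times> real) set)) = (1, 1)"
  proof -
    have B: "(Basis :: (real \<times> real) set) = {(1, 0), (0, 1)}" by (auto simp: Basis_prod_def)
    show ?thesis unfolding B by simp
  qed
  obtain N where N: "negligible N"
    and d: "\<And>x e. x \<notin> N \<Longrightarrow> 0 < e \<Longrightarrow> \<exists>d>0. \<forall>h. 0 < h \<and> h < d \<longrightarrow>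
       norm (integral (cbox x (x + h *\<^sub>R One)) f /\<^sub>R h ^ DIM(real \<times> real) - f x) < e"
    by (rule integrable_ccontinuous_explicit[OF locally_integrable_integrable[OF f]]) (rule that)
  have eq: "integral (cbox x (x + h *\<^sub>R One)) f /\<^sub>R h ^ DIM(real \<times> real) = steklov_mean h f x" for x h
    unfolding One by (cases x) (simp add: steklov_mean_def rect_integral_def divide_inverse mult.commute power2_eq_square)
  have "(\<lambda>n. steklov_mean (inverse (real (Suc n))) f z) \<longlonglongrightarrow> f z" if "z \<notin> N" for z
  proof (rule LIMSEQ_I)
    fix r :: real assume "0 < r"
    with d[OF that this] obtain d where d: "d > 0" "\<And>h. 0 < h \<Longrightarrow> h < d \<Longrightarrow> norm (steklov_mean h f z - f z) < r"
      unfolding eq by blast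
    obtain n0 where n0: "inverse (real (Suc n0)) < d" using reals_Archimedean[OF d(1)] by blast
    show "\<exists>no. \<forall>n\<ge>no. norm (steklov_mean (inverse (real (Suc n))) f z - f z) < r"
    proof (intro exI allI impI d(2))
      fix n assume "n0 \<le> n"
      then have "inverse (real (Suc n)) \<le> inverse (real (Suc n0))" by (intro le_imp_inverse_le) auto
      then show "inverse (real (Suc n)) < d" using n0 by linarith
    qed simp
  qed
  moreover have "AE z in lebesgue. z \<notin> N"
    using N by (intro AE_not_in) (simp add: negligible_iff_null_sets)
  ultimately show ?thesis by (simp add: eventually_mono)
qed

section \<open>From small increments to the modulus of continuity\<close>

definition mixed_diff_norm :: "(real \<times> real \<Rightarrow> real) \<Rightarrow> real \<Rightarrow> real \<Rightarrow> real" where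
  "mixed_diff_norm f s t = rect_integral (\<lambda>z. \<bar>mixed_diff s t f z\<bar>) 0 1 0 1"

lemma rect_integral_mono:
  assumes "locally_integrable f" "locally_integrable g" "\<And>z. f z \<le> g z"
  shows "rect_integral f a b c d \<le> rect_integral g a b c d"
  unfolding rect_integral_def using assms by (intro integral_le locally_integrable_integrable)

lemma rect_integral_period_shift:
  assumes f: "locally_integrable f" and p: "periodic2 f"
  shows "rect_integral (\<lambda>z. f (z + w)) 0 1 0 1 = rect_integral f 0 1 0 1"
  using rect_integral_shift[of f "fst w" "snd w" 0 1 0 1] rect_integral_period[OF f p, of "fst w" "snd w"]
  by (simp add: add.commute)

lemma periodic2_abs_mixed_diff: "periodic2 f \<Longrightarrow> periodic2 (\<lambda>z. \<bar>mixed_diff s t f z\<bar>)"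
  using periodic2_mixed_diff[of f s t] by (simp add: periodic2_def)

context
  fixes f :: "real \<times> real \<Rightarrow> real"
  assumes li: "locally_integrable f" and per: "periodic2 f"
begin

lemma L1_norm_mixed_diff: "L1_norm (mixed_diff s t f) = ennreal (mixed_diff_norm f s t)"
  unfolding mixed_diff_norm_def
  by (rule L1_norm_eq_rect_integral[OF locally_integrable_mixed_diff[OF li]])

lemma mixed_diff_norm_nonneg: "0 \<le> mixed_diff_norm f s t"
  using rect_integral_abs[OF locally_integrable_mixed_diff[OF li], of s t 0 1 0 1]
  by (simp add: mixed_diff_norm_def)

text \<open>
  The triangle inequality in \<open>L\<^sup>1\<close>; translating a periodic function does not change its norm.
\<close>
lemma mixed_diff_norm_le_sum:
  assumes "\<And>z. mixed_diff s t f z = mixed_diff s1 t1 f (z + w) + mixed_diff s2 t2 f z"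
  shows "mixed_diff_norm f s t \<le> mixed_diff_norm f s1 t1 + mixed_diff_norm f s2 t2"
proof -
  note l = locally_integrable_intros(1)[OF locally_integrable_mixed_diff[OF li]]
  have "mixed_diff_norm f s t \<le>
      rect_integral (\<lambda>z. \<bar>mixed_diff s1 t1 f (z + w)\<bar> + \<bar>mixed_diff s2 t2 f z\<bar>) 0 1 0 1"
    unfolding mixed_diff_norm_def
    by (intro rect_integral_mono l locally_integrable_intros(2) locally_integrable_shift[OF l])
       (simp add: assms abs_triangle_ineq)
  also have "\<dots> = mixed_diff_norm f s1 t1 + mixed_diff_norm f s2 t2"
    unfolding mixed_diff_norm_def
    by (simp add: rect_integral_add(1) l locally_integrable_shift[OF l]
        rect_integral_period_shift[OF l periodic2_abs_mixed_diff[OF per]])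
  finally show ?thesis .
qed

lemma mixed_diff_norm_add:
  "mixed_diff_norm f (s + s') t \<le> mixed_diff_norm f s t + mixed_diff_norm f s' t"
  "mixed_diff_norm f s (t + t') \<le> mixed_diff_norm f s t + mixed_diff_norm f s t'"
  by (rule mixed_diff_norm_le_sum[of _ _ _ _ "(s', 0)"], force simp: mixed_diff_def algebra_simps)
     (rule mixed_diff_norm_le_sum[of _ _ _ _ "(0, t')"], force simp: mixed_diff_def algebra_simps)

lemma mixed_diff_norm_0: "mixed_diff_norm f 0 t = 0" "mixed_diff_norm f s 0 = 0"
  by (simp_all add: mixed_diff_norm_def mixed_diff_def rect_integral_def case_prod_beta)

lemma mixed_diff_norm_mult:
  "mixed_diff_norm f (real p * s) (real q * t) \<le> real p * real q * mixed_diff_norm f s t"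
proof -
  have 1: "mixed_diff_norm f (real p * s) t \<le> real p * mixed_diff_norm f s t" for s t
  proof (induction p)
    case (Suc p)
    then show ?case using mixed_diff_norm_add(1)[of s "real p * s" t] by (simp add: algebra_simps)
  qed (simp add: mixed_diff_norm_0)
  have 2: "mixed_diff_norm f s (real q * t) \<le> real q * mixed_diff_norm f s t"
  proof (induction q)
    case (Suc q)
    then show ?case using mixed_diff_norm_add(2)[of s t "real q * t"] by (simp add: algebra_simps)
  qed (simp add: mixed_diff_norm_0)
  have "mixed_diff_norm f (real p * s) (real q * t) \<le> real p * mixed_diff_norm f s (real q * t)" by (rule 1)
  also have "\<dots> \<le> real p * (real q * mixed_diff_norm f s t)" by (intro mult_left_mono 2) simp
  finally show ?thesis by (simp add: mult.assoc)
qed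

text \<open>
  Rounding \<open>s\<close> and \<open>t\<close> down to the multiples \<open>\<sigma>\<close> and \<open>\<tau>\<close> of \<open>1 / N\<close>, subadditivity splits the norm
  into a main part, made of grid steps and bounded by \<open>V\<close>, and two remainders in which one of the steps
  is at most \<open>1 / N\<close>. The crude constant \<open>C\<close> is only used for the remainders, which disappear as
  \<open>N\<close> grows, so it does not enter the final bound.
\<close>
lemma mixed_diff_norm_le_of_grid:
  assumes C: "\<And>s t. 0 < s \<Longrightarrow> 0 < t \<Longrightarrow> mixed_diff_norm f s t \<le> C * (s * t)"
    and V: "\<And>n. mixed_diff_norm f (1 / real (Suc n)) (1 / real (Suc n)) \<le> V / (real (Suc n))\<^sup>2"
    and st: "0 \<le> s" "0 \<le> t"
  shows "mixed_diff_norm f s t \<le> V * (s * t)"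
proof (rule LIMSEQ_le_const)
  have C0: "0 \<le> C" using order.trans[OF mixed_diff_norm_nonneg C[of 1 1]] by simp
  have V0: "0 \<le> V" using order.trans[OF mixed_diff_norm_nonneg V[of 0]] by simp
  have C': "mixed_diff_norm f s t \<le> C * (s * t)" if "0 \<le> s" "0 \<le> t" for s t
    using C[of s t] that mixed_diff_norm_0 by (cases "s = 0 \<or> t = 0") auto
  show "(\<lambda>n. V * (s * t) + C * (s + t) * inverse (real (Suc n))) \<longlonglongrightarrow> V * (s * t)"
    using tendsto_add[OF tendsto_const tendsto_mult[OF tendsto_const LIMSEQ_inverse_real_of_nat], of "V * (s * t)" "C * (s + t)"]
    by simp
  show "\<exists>N. \<forall>n\<ge>N. mixed_diff_norm f s t \<le> V * (s * t) + C * (s + t) * inverse (real (Suc n))"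
  proof (intro exI allI impI)
    fix n :: nat
    define N where "N = real (Suc n)"
    have N: "N > 0" by (simp add: N_def)
    \<comment> \<open>The first \<open>p\<close> steps of length \<open>1 / N\<close> reach \<open>\<sigma>\<close>, and the first \<open>q\<close> reach \<open>\<tau>\<close>.\<close>
    define p q where "p = nat \<lfloor>N * s\<rfloor>" and "q = nat \<lfloor>N * t\<rfloor>"
    define \<sigma> \<tau> where "\<sigma> = real p * (1 / N)" and "\<tau> = real q * (1 / N)"
    have fl: "real p \<le> N * s" "N * s \<le> real p + 1" "real q \<le> N * t" "N * t \<le> real q + 1"
      using N st unfolding p_def q_def by (auto simp: of_nat_nat)
    have b: "0 \<le> \<sigma>" "\<sigma> \<le> s" "s - \<sigma> \<le> 1 / N" "0 \<le> \<tau>" "\<tau> \<le> t" "t - \<tau> \<le> 1 / N"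
    proof -
      have "s \<le> (real p + 1) / N" "t \<le> (real q + 1) / N" "real p / N \<le> s" "real q / N \<le> t"
        using fl N by (simp_all add: pos_le_divide_eq pos_divide_le_eq mult.commute)
      then show "\<sigma> \<le> s" "s - \<sigma> \<le> 1 / N" "\<tau> \<le> t" "t - \<tau> \<le> 1 / N"
        by (simp_all add: \<sigma>_def \<tau>_def add_divide_distrib)
      show "0 \<le> \<sigma>" "0 \<le> \<tau>" using N by (simp_all add: \<sigma>_def \<tau>_def)
    qed
    have "mixed_diff_norm f s t \<le> mixed_diff_norm f \<sigma> t + mixed_diff_norm f (s - \<sigma>) t"
      using mixed_diff_norm_add(1)[of \<sigma> "s - \<sigma>" t] by simp
    also have "mixed_diff_norm f \<sigma> t \<le> mixed_diff_norm f \<sigma> \<tau> + mixed_diff_norm f \<sigma> (t - \<tau>)"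
      using mixed_diff_norm_add(2)[of \<sigma> \<tau> "t - \<tau>"] by simp
    also have "mixed_diff_norm f \<sigma> \<tau> \<le> real p * real q * mixed_diff_norm f (1 / N) (1 / N)"
      unfolding \<sigma>_def \<tau>_def by (rule mixed_diff_norm_mult)
    also have "\<dots> \<le> real p * real q * (V / N\<^sup>2)"
      using V[of n] by (intro mult_left_mono) (auto simp: N_def)
    also have "\<dots> = V * (\<sigma> * \<tau>)" by (simp add: \<sigma>_def \<tau>_def power2_eq_square)
    also have "\<dots> \<le> V * (s * t)" using b st V0 by (intro mult_left_mono mult_mono) auto
    also have "mixed_diff_norm f \<sigma> (t - \<tau>) \<le> C * (s * (1 / N))"
      by (rule order.trans[OF C']) (use b st C0 in \<open>auto intro!: mult_left_mono mult_mono simp del: times_divide_eq_right\<close>)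
    also have "mixed_diff_norm f (s - \<sigma>) t \<le> C * (1 / N * t)"
      by (rule order.trans[OF C']) (use b st C0 in \<open>auto intro!: mult_left_mono mult_right_mono simp del: times_divide_eq_left\<close>)
    finally show "mixed_diff_norm f s t \<le> V * (s * t) + C * (s + t) * inverse (real (Suc n))"
      unfolding N_def[symmetric] by (simp add: divide_inverse algebra_simps)
  qed
qed

text \<open>
  The norm does not change under translations, so \<open>N\<^sup>2\<close> times the norm is the integral over the
  unit square of \<open>S\<close>, the sum of the absolute increments at all \<open>N\<^sup>2\<close> translates by multiples of
  \<open>1 / N\<close>. For almost every \<open>z\<close> the decomposition of \<open>f\<close> holds at the finitely many points that occur
  in \<open>S z\<close>; the functions of one variable cancel there, and \<open>S z\<close> is the sum of \<open>g\<close> over a uniform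
  net, hence at most the variation of \<open>g\<close>.
\<close>
lemma mixed_diff_norm_grid_le_variation2:
  assumes g: "AE (x, y) in lebesgue. f (x, y) = g (x, y) + \<phi>1 x + \<phi>2 y"
    and V: "variation2 g = ennreal V" and V0: "0 \<le> V"
  shows "mixed_diff_norm f (1 / real (Suc n)) (1 / real (Suc n)) \<le> V / (real (Suc n))\<^sup>2"
proof -
  define N where "N = Suc n"
  define h where "h = 1 / real N"
  define p where "p i = real i * h" for i
  have Nh: "real N * h = 1" and N: "N > 0" and h: "h > 0" by (simp_all add: h_def N_def)
  let ?D = "\<lambda>z. \<bar>mixed_diff h h f z\<bar>"
  let ?I = "{..<N} \<times> {..<N}"
  define S where "S z = (\<Sum>(i, j)\<in>?I. ?D (z + (p i, p j)))" for z
  note l = locally_integrable_intros(1)[OF locally_integrable_mixed_diff[OF li]]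
  note lw = locally_integrable_shift[OF l]
  have S: "locally_integrable S"
    unfolding S_def locally_integrable_def case_prod_beta
    by (intro allI absolutely_integrable_sum lw[unfolded locally_integrable_def, rule_format]) simp
  have unit: "{0..1} \<times> {0..1} = cbox (0, 0) (1 :: real, 1 :: real)"
    by (simp add: cbox_Pair_eq)
  have B: "(Basis :: (real \<times> real) set) = {(1, 0), (0, 1)}"
    by (auto simp: Basis_prod_def)
  have S0: "S z \<ge> 0" for z unfolding S_def by (intro sum_nonneg) auto
  have "rect_integral S 0 1 0 1 = (\<Sum>(i, j)\<in>?I. rect_integral (\<lambda>z. ?D (z + (p i, p j))) 0 1 0 1)"
    unfolding rect_integral_def S_def case_prod_beta
    by (intro integral_sum locally_integrable_integrable lw) simp
  also have "\<dots> = (\<Sum>(i, j)\<in>?I. mixed_diff_norm f h h)"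
    unfolding mixed_diff_norm_def by (simp add: rect_integral_period_shift[OF l periodic2_abs_mixed_diff[OF per]])
  also have "\<dots> = (real N)\<^sup>2 * mixed_diff_norm f h h"
    by (simp add: power2_eq_square card_cartesian_product)
  finally have eq: "rect_integral S 0 1 0 1 = (real N)\<^sup>2 * mixed_diff_norm f h h" .
  define Q where "Q = (\<lambda>z. f z = g z + \<phi>1 (fst z) + \<phi>2 (snd z))"
  have "AE z in lebesgue. Q z" using g by (simp add: Q_def case_prod_beta)
  then have "AE z in lebesgue. \<forall>w\<in>{..N} \<times> {..N}. Q (z + (p (fst w), p (snd w)))"
    by (intro AE_finite_allI AE_lebesgue_shift) auto
  then have "AE z in lebesgue. S z \<le> V"
  proof (rule AE_mp, intro AE_I2 impI)
    fix z assume Q: "\<forall>w\<in>{..N} \<times> {..N}. Q (z + (p (fst w), p (snd w)))"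
    obtain a b where z: "z = (a, b)" by (cases z)
    have fe: "f (a + p i, b + p j) = g (a + p i, b + p j) + \<phi>1 (a + p i) + \<phi>2 (b + p j)"
      if "i \<le> N" "j \<le> N" for i j
      using Q[rule_format, of "(i, j)"] that by (simp add: Q_def z)
    have ps: "p i + h = p (Suc i)" for i by (simp add: p_def algebra_simps)
    have "S z = net_sum g N (\<lambda>i. a + p i) N (\<lambda>j. b + p j)"
      unfolding S_def net_sum_def sum.cartesian_product
    proof (intro sum.cong refl, clarify)
      fix i j assume "i < N" "j < N"
      then show "?D (z + (p i, p j)) = \<bar>rect_diff g (a + p i) (a + p (Suc i)) (b + p j) (b + p (Suc j))\<bar>"
        by (simp add: mixed_diff_def z rect_diff_def add.assoc ps fe)
    qed
    moreover have "period_partition N (\<lambda>i. a + p i)" "period_partition N (\<lambda>i. b + p i)"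
      using Nh h by (auto simp: period_partition_def p_def algebra_simps)
    ultimately have "ennreal (S z) \<le> ennreal V"
      using net_sum_le_variation2[of N "\<lambda>i. a + p i" N "\<lambda>j. b + p j" g] V by simp
    then show "S z \<le> V" using V0 by simp
  qed
  then have "AE z in lebesgue. ennreal \<bar>S z\<bar> * indicator ({0..1} \<times> {0..1}) z
      \<le> ennreal V * indicator ({0..1} \<times> {0..1}) z"
    by (rule eventually_mono) (simp add: S0 mult_right_mono ennreal_leI)
  then have "L1_norm S \<le> (\<integral>\<^sup>+ z \<in> {0..1} \<times> {0..1}. ennreal V \<partial>(lebesgue :: (real \<times> real) measure))"
    unfolding L1_norm_def by (rule nn_integral_mono_AE)
  also have "\<dots> = ennreal V * emeasure lebesgue (cbox (0, 0) (1 :: real, 1 :: real))"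
    unfolding unit by (rule nn_integral_cmult_indicator) simp
  also have "\<dots> = ennreal V"
    by (simp add: emeasure_lborel_cbox_eq B)
  finally have "rect_integral S 0 1 0 1 \<le> V"
    using V0 S0 by (simp add: L1_norm_eq_rect_integral[OF S])
  then show ?thesis using N unfolding eq by (simp add: h_def N_def field_simps)
qed

end

section \<open>The decomposition\<close>

theorem theorem4p1:
  fixes f :: "real \<times> real \<Rightarrow> real"
  assumes "f \<in> L1_periodic"
    and "\<exists>C::real. \<forall>u>0. \<forall>v>0. mixed_modulus f u v \<le> ennreal (C * (u * v))"
  shows "\<exists>(g :: real \<times> real \<Rightarrow> real) (\<phi>1 :: real \<Rightarrow> real) (\<phi>2 :: real \<Rightarrow> real).
           g \<in> H12 \<and>
           (AE (x, y) in lebesgue. f (x, y) = g (x, y) + \<phi>1 x + \<phi>2 y) \<and>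
           variation2 g =
             (SUP (u, v) \<in> {0<..} \<times> {0<..}. mixed_modulus f u v / ennreal (u * v))"
proof -
  let ?R = "SUP (u, v) \<in> {0<..} \<times> {0<..}. mixed_modulus f u v / ennreal (u * v)"
  have li: "locally_integrable f" and per: "periodic2 f"
    using assms(1) locally_integrable_L1_periodic by (auto simp: L1_periodic_def)
  from assms(2) obtain C0 :: real where
    C0: "\<And>u v. 0 < u \<Longrightarrow> 0 < v \<Longrightarrow> mixed_modulus f u v \<le> ennreal (C0 * (u * v))" by blast
  \<comment> \<open>A negative constant would make the right-hand side \<open>0\<close> in \<^typ>\<open>ennreal\<close>; its absolute value is still a bound.\<close>
  define C where "C = \<bar>C0\<bar>"
  have C: "mixed_modulus f u v \<le> ennreal (C * (u * v))" if "0 < u" "0 < v" for u v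
  proof -
    have "C0 * (u * v) \<le> C * (u * v)"
      using that by (intro mult_right_mono) (auto simp: C_def)
    from order.trans[OF C0[OF that] ennreal_leI[OF this]] show ?thesis .
  qed
  have "?R \<le> ennreal C"
  proof (rule SUP_least, clarsimp)
    fix u v :: real assume uv: "0 < u" "0 < v"
    have "mixed_modulus f u v / ennreal (u * v) \<le> ennreal (C * (u * v)) / ennreal (u * v)"
      by (rule divide_right_mono_ennreal[OF C[OF uv]])
    also have "\<dots> = ennreal C" using uv by (simp add: divide_ennreal C_def)
    finally show "mixed_modulus f u v / ennreal (u * v) \<le> ennreal C" .
  qed
  then obtain L where L: "?R = ennreal L" "0 \<le> L"
    by (cases ?R) (auto simp: top_unique)

  define F where "F n = steklov_mean (inverse (real (Suc n))) f" for n
  have F: "variation2 (F n) \<le> ennreal L" for n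
  proof -
    let ?h = "inverse (real (Suc n))"
    have h: "0 < ?h" by simp
    have "variation2 (F n) \<le> L1_norm (mixed_diff ?h ?h f) / ennreal (?h * ?h)"
      unfolding F_def by (rule variation2_steklov_mean_le[OF li per h])
    also have "\<dots> \<le> mixed_modulus f ?h ?h / ennreal (?h * ?h)"
      unfolding mixed_modulus_def by (intro divide_right_mono_ennreal SUP_upper2[of "(?h, ?h)"]) auto
    also have "\<dots> \<le> ?R" by (rule SUP_upper2[of "(?h, ?h)"]) auto
    finally show ?thesis using L by simp
  qed
  \<comment> \<open>The averages must converge at the base point and on almost all of the two lines through it,
    since the normalization evaluates them there.\<close>
  obtain x0 y0 where z0: "(\<lambda>n. F n (x0, y0)) \<longlonglongrightarrow> f (x0, y0)"
    and ae: "AE (x, y) in lebesgue. (\<lambda>n. F n (x, y0)) \<longlonglongrightarrow> f (x, y0) \<and> (\<lambda>n. F n (x0, y)) \<longlonglongrightarrow> f (x0, y)"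
    using steklov_mean_tendsto_AE[OF li, folded F_def] by (rule generic_point)
  define G where "G n = anchored x0 y0 (F n)" for n
  have "periodic2 (F n)" for n unfolding F_def by (rule periodic2_steklov_mean[OF per])
  then have G: "periodic2 (G n)" "variation2 (G n) \<le> ennreal L" for n
    unfolding G_def variation2_anchored using F by (simp_all add: periodic2_anchored)
  have G0: "G n (x0, y) = 0" "G n (x, y0) = 0" for n x y
    by (simp_all add: G_def anchored_def)
  have "\<bar>G n z\<bar> \<le> L" for n z
    using order.trans[OF abs_le_variation2[OF G(1) G0] G(2)] L(2) by simp
  then obtain g where g: "periodic2 g" "variation2 g \<le> ennreal L"
    and lim: "\<And>z l. (\<lambda>n. G n z) \<longlonglongrightarrow> l \<Longrightarrow> g z = l"
    using Helly_variation2[of G L L, OF G(1,2)] by blast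
  have "g (x0, y) = 0" "g (x, y0) = 0" for x y
    using lim[of "(x0, y)" 0] lim[of "(x, y0)" 0] by (simp_all add: G0)
  moreover have "variation2 g < \<infinity>" using g(2) by (simp add: order.strict_trans1)
  ultimately have H12: "g \<in> H12" using g(1) by (intro H12_I)

  \<comment> \<open>The pieces removed by the normalization, in the limit.\<close>
  define \<phi>1 \<phi>2 where "\<phi>1 x = f (x, y0) - f (x0, y0)" and "\<phi>2 y = f (x0, y)" for x y
  have dec: "AE (x, y) in lebesgue. f (x, y) = g (x, y) + \<phi>1 x + \<phi>2 y"
    using steklov_mean_tendsto_AE[OF li, folded F_def] ae
  proof eventually_elim
    case (elim z)
    obtain x y where z: "z = (x, y)" by (cases z)
    have "(\<lambda>n. G n (x, y)) \<longlonglongrightarrow> f (x, y) - f (x0, y) - f (x, y0) + f (x0, y0)"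
      unfolding G_def anchored_def using elim z0 by (auto simp: z intro!: tendsto_intros)
    from lim[OF this] show ?case by (simp add: z \<phi>1_def \<phi>2_def)
  qed

  obtain V where V: "variation2 g = ennreal V" "0 \<le> V"
    using g(2) by (cases "variation2 g") (auto simp: top_unique)
  have Cn: "mixed_diff_norm f s t \<le> C * (s * t)" if "0 < s" "0 < t" for s t
  proof -
    have "ennreal (mixed_diff_norm f s t) \<le> mixed_modulus f s t"
      unfolding mixed_modulus_def L1_norm_mixed_diff[OF li per, symmetric]
      using that by (intro SUP_upper2[of "(s, t)"]) auto
    also have "\<dots> \<le> ennreal (C * (s * t))" by (rule C[OF that])
    finally show ?thesis using that by (simp add: C_def)
  qed
  have *: "mixed_diff_norm f s t \<le> V * (s * t)" if "0 \<le> s" "0 \<le> t" for s t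
    by (rule mixed_diff_norm_le_of_grid[OF li per _ _ that])
      (rule Cn, assumption+, rule mixed_diff_norm_grid_le_variation2[OF li per dec V])
  have "?R \<le> ennreal V"
  proof (rule SUP_least, clarsimp)
    fix u v :: real assume uv: "0 < u" "0 < v"
    have "mixed_modulus f u v \<le> ennreal (V * (u * v))"
      unfolding mixed_modulus_def
    proof (rule SUP_least, clarsimp)
      fix s t assume st: "0 \<le> s" "s \<le> u" "0 \<le> t" "t \<le> v"
      have "mixed_diff_norm f s t \<le> V * (s * t)" by (rule *[OF st(1,3)])
      also have "\<dots> \<le> V * (u * v)" using st V by (intro mult_left_mono mult_mono) auto
      finally show "L1_norm (mixed_diff s t f) \<le> ennreal (V * (u * v))"
        by (simp add: L1_norm_mixed_diff[OF li per] ennreal_leI)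
    qed
    then have "mixed_modulus f u v / ennreal (u * v) \<le> ennreal (V * (u * v)) / ennreal (u * v)"
      by (rule divide_right_mono_ennreal)
    also have "\<dots> = ennreal V" using uv V by (simp add: divide_ennreal)
    finally show "mixed_modulus f u v / ennreal (u * v) \<le> ennreal V" .
  qed
  then have "variation2 g = ?R" using V g(2) L(1) by (intro antisym) auto
  with H12 dec show ?thesis by blast
qed

end
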